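(* Consider a Quotient Hash Table (QHT) with $N$ rows, $k$ cells (buckets) per row and $S$ possible fingerprints, with $1\le k\le S$. Under the probabilistic model described in the context (random hash functions, uniformly random stream, all cells already non-empty), the probability that an unseen element $e$, arriving after $m$ other elements have been inserted, is a false positive equals $$\operatorname{FP}_m=\frac{k}{S}\left(1-\left[1-\frac{1}{Nk}\right]^m\right).$$ Consequently the false positive rate $\operatorname{FPR}_n=\frac1n\sum_{m=1}^n \operatorname{FP}_m$ of a stream of $n$ elements satisfies $\operatorname{FPR}_n\to \frac{k}{S}$ as $n\to\infty$.
   Context: Let $\Gamma$ be a finite set of elements with $U=|\Gamma|$, and let $E=(e_1,e_2,\dots)$ be a stream of elements of $\Gamma$. An element $e_i$ is a duplicate if $e_j=e_i$ for some $j<i$, and unseen otherwise. A QHT has a state $T$ which is an $N\times k$ array whose cells are either empty or contain a fingerprint in $\{0,\dots,S-1\}$; initially all cells are empty. It uses a hash function $h:\Gamma\to\{0,\dots,N-1\}$ (the row) and a fingerprint function $s:\Gamma\to\{0,\dots,S-1\}$. Processing an element $e$: if some cell of row $T[h(e)]$ contains $s(e)$, output DUPLICATE and leave the state unchanged; otherwise store $s(e)$ in the first empty cell of row $T[h(e)]$, or, if the row has no empty cell, in a cell of that row chosen uniformly at random (overwriting its content), and output UNSEEN. A false positive is an unseen element for which the output is DUPLICATE. Model assumptions: $h$ and $s$ are modelled as independent uniformly random functions (so that for each element the pair $(h(e),s(e))$ is uniform over the $NS$ possibilities), the stream elements are sampled independently and uniformly from $\Gamma$, and every cell of the table is assumed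 to be non-empty (as is the case after sufficiently many insertions).
   Formalization: FP_m is conditioned on the m inserted elements being pairwise distinct and on e's fingerprint being absent from its row of the initial full reachable table (otherwise the formula fails); this needs U > m, universes with U_n > n in the limit, and excludes k = S. *)

theory Defs
  imports "HOL-Probability.Probability"
begin

text \<open>
  A table maps a row index and a cell index to a cell content, with \<open>None\<close> for an empty cell.
  Only rows below \<open>N\<close> and cells below \<open>k\<close> are ever inspected or modified.
\<close>

type_synonym qht_table = "nat \<Rightarrow> nat \<Rightarrow> nat option"

datatype qht_output = DUPLICATE | UNSEEN

definition qht_empty :: qht_table where
  "qht_empty = (\<lambda>_ _. None)"

definition qht_stored :: "nat \<Rightarrow> qht_table \<Rightarrow> nat \<Rightarrow> nat \<Rightarrow> bool" where
  "qht_stored k T r f \<longleftrightarrow> (\<exists>j<k. T r j = Some f)"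

definition qht_write :: "qht_table \<Rightarrow> nat \<Rightarrow> nat \<Rightarrow> nat \<Rightarrow> qht_table" where
  "qht_write T r j f = T(r := (T r)(j := Some f))"

definition qht_insert :: "nat \<Rightarrow> nat \<Rightarrow> nat \<Rightarrow> qht_table \<Rightarrow> qht_table pmf" where
  "qht_insert k r f T =
     (if \<exists>j<k. T r j = None
      then return_pmf (qht_write T r (LEAST j. j < k \<and> T r j = None) f)
      else map_pmf (\<lambda>j. qht_write T r j f) (pmf_of_set {..<k}))"

definition qht_process :: "nat \<Rightarrow> nat \<Rightarrow> nat \<Rightarrow> qht_table \<Rightarrow> (qht_output \<times> qht_table) pmf" where
  "qht_process k r f T =
     (if qht_stored k T r f then return_pmf (DUPLICATE, T)
      else map_pmf (\<lambda>T'. (UNSEEN, T')) (qht_insert k r f T))"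

primrec qht_outputs ::
  "nat \<Rightarrow> ('a \<Rightarrow> nat) \<Rightarrow> ('a \<Rightarrow> nat) \<Rightarrow> 'a list \<Rightarrow> qht_table \<Rightarrow> qht_output list pmf" where
  "qht_outputs k h s [] T = return_pmf []"
| "qht_outputs k h s (e # es) T =
     do { (b, T') \<leftarrow> qht_process k (h e) (s e) T;
          bs \<leftarrow> qht_outputs k h s es T';
          return_pmf (b # bs) }"

inductive qht_reachable :: "nat \<Rightarrow> nat \<Rightarrow> nat \<Rightarrow> qht_table \<Rightarrow> bool" for N k S where
  "qht_reachable N k S qht_empty"
| "qht_reachable N k S T \<Longrightarrow> r < N \<Longrightarrow> f < S \<Longrightarrow> (b, T') \<in> set_pmf (qht_process k r f T)
     \<Longrightarrow> qht_reachable N k S T'"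

definition qht_full :: "nat \<Rightarrow> nat \<Rightarrow> qht_table \<Rightarrow> bool" where
  "qht_full N k T \<longleftrightarrow> (\<forall>r<N. \<forall>j<k. T r j \<noteq> None)"

definition unseen_at :: "'a list \<Rightarrow> nat \<Rightarrow> bool" where
  "unseen_at es i \<longleftrightarrow> \<not> (\<exists>j<i. es ! j = es ! i)"

definition false_positive_at :: "'a list \<Rightarrow> qht_output list \<Rightarrow> nat \<Rightarrow> bool" where
  "false_positive_at es bs i \<longleftrightarrow> unseen_at es i \<and> bs ! i = DUPLICATE"

text \<open>
  The joint law of the stream of length \<open>l\<close>, the hash function, the fingerprint function and the
  list of outputs, where \<open>T0\<close> is the table at the time the stream starts.
\<close>

definition qht_experiment ::
  "'a set \<Rightarrow> nat \<Rightarrow> nat \<Rightarrow> nat \<Rightarrow> qht_table \<Rightarrow> nat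
     \<Rightarrow> ('a list \<times> ('a \<Rightarrow> nat) \<times> ('a \<Rightarrow> nat) \<times> qht_output list) pmf" where
  "qht_experiment \<Gamma> N k S T0 l =
     do { es \<leftarrow> replicate_pmf l (pmf_of_set \<Gamma>);
          h \<leftarrow> pmf_of_set (\<Gamma> \<rightarrow>\<^sub>E {..<N});
          s \<leftarrow> pmf_of_set (\<Gamma> \<rightarrow>\<^sub>E {..<S});
          bs \<leftarrow> qht_outputs k h s es T0;
          return_pmf (es, h, s, bs) }"

text \<open>
  The element \<open>e\<close> of interest is the one at position \<open>m\<close>, after the \<open>m\<close> elements at positions
  \<open>0, \<dots>, m - 1\<close>. We condition on three events: \<open>e\<close> is unseen; the \<open>m\<close> elements before it
  are pairwise different, so that their hash pairs are independent; and the fingerprint of \<open>e\<close> is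
  not already in its row of \<open>T0\<close>, so that a collision can only come from those \<open>m\<close> elements.
  The last event is the convention that the probability is 0 for \<open>m = 0\<close>.
\<close>

definition qht_FP :: "'a set \<Rightarrow> nat \<Rightarrow> nat \<Rightarrow> nat \<Rightarrow> qht_table \<Rightarrow> nat \<Rightarrow> real" where
  "qht_FP \<Gamma> N k S T0 m =
     cond_prob (measure_pmf (qht_experiment \<Gamma> N k S T0 (Suc m)))
       (\<lambda>(es, h, s, bs). false_positive_at es bs m)
       (\<lambda>(es, h, s, bs). unseen_at es m \<and> distinct (take m es)
          \<and> \<not> qht_stored k T0 (h (es ! m)) (s (es ! m)))"

definition qht_FPR :: "'a set \<Rightarrow> nat \<Rightarrow> nat \<Rightarrow> nat \<Rightarrow> qht_table \<Rightarrow> nat \<Rightarrow> real" where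
  "qht_FPR \<Gamma> N k S T0 n = (1 / real n) * (\<Sum>m = 1..n. qht_FP \<Gamma> N k S T0 m)"

end

theory Submission
  imports Defs
begin

text \<open>
  Fix a row \<open>r\<close> and a fingerprint \<open>f\<close>. A row of a full reachable table holds \<open>k\<close> different
  fingerprints, so a uniformly random pair \<open>(r', f')\<close> stores \<open>f\<close> in row \<open>r\<close> with probability
  \<open>1 / (N S)\<close> if it is absent, and evicts it with probability \<open>(S - k) / (N S k)\<close> if it is
  present. Hence the probability \<open>p\<close> of \<open>f\<close> being stored evolves by the affine map
  \<open>p \<mapsto> (1 - 1 / (N k)) p + 1 / (N S)\<close>, whose fixed point is \<open>k / S\<close>, whatever the state of the table.
  Conditioned on the elements being pairwise different, the hash pairs are independent and uniform,
  and the pair of the last element is independent of the earlier ones.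
\<close>

section \<open>Invariants of the table under processing\<close>

text \<open>Empty cells are exempt from the injectivity clause, so the initial table qualifies and
  the property passes to every reachable table.\<close>

definition qht_wf :: "nat \<Rightarrow> nat \<Rightarrow> nat \<Rightarrow> qht_table \<Rightarrow> bool" where
  "qht_wf N k S T \<longleftrightarrow>
     (\<forall>r<N. (\<forall>j<k. \<forall>f. T r j = Some f \<longrightarrow> f < S) \<and>
       (\<forall>i<k. \<forall>j<k. T r i = T r j \<longrightarrow> T r i \<noteq> None \<longrightarrow> i = j))"

lemma set_pmf_qht_process:
  assumes "k > 0" "(b, T') \<in> set_pmf (qht_process k r f T)"
  shows "T' = T \<or> (\<not> qht_stored k T r f \<and> (\<exists>j<k. T' = qht_write T r j f))"
proof (cases "\<not> qht_stored k T r f \<and> (\<exists>j<k. T r j = None)")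
  case True
  then have "(LEAST j. j < k \<and> T r j = None) < k"
    using LeastI_ex[of "\<lambda>j. j < k \<and> T r j = None"] by blast
  then show ?thesis using True assms by (auto simp: qht_process_def qht_insert_def)
next
  case False
  then show ?thesis using assms
    by (auto simp: qht_process_def qht_insert_def set_pmf_of_set lessThan_empty_iff split: if_splits)
qed

text \<open>The stored content cannot clash with another cell of the row, because \<open>f\<close>
  occurs nowhere in it; this is why processing looks for \<open>f\<close> before inserting.\<close>

lemma qht_wf_write:
  assumes "qht_wf N k S T" "f < S" "\<not> qht_stored k T r f"
  shows "qht_wf N k S (qht_write T r j f)"
  using assms unfolding qht_wf_def qht_write_def qht_stored_def
  by (auto split: if_splits)

lemma qht_wf_process:
  assumes "k > 0" "qht_wf N k S T" "f < S" "(b, T') \<in> set_pmf (qht_process k r f T)"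
  shows "qht_wf N k S T'"
  using set_pmf_qht_process[OF assms(1,4)] qht_wf_write assms by blast

lemma qht_full_process:
  assumes "k > 0" "qht_full N k T" "(b, T') \<in> set_pmf (qht_process k r f T)"
  shows "qht_full N k T'"
  using set_pmf_qht_process[OF assms(1,3)] assms(2)
  by (auto simp: qht_full_def qht_write_def)

lemma qht_reachable_wf:
  assumes "qht_reachable N k S T" "k > 0"
  shows "qht_wf N k S T"
  using assms
proof induction
  case 1
  then show ?case by (simp add: qht_wf_def qht_empty_def)
next
  case (2 T r f b T')
  then show ?case using qht_wf_process by blast
qed

lemma finite_set_pmf_qht_process:
  assumes "k > 0"
  shows "finite (set_pmf (qht_process k r f T))"
  using assms by (auto simp: qht_process_def qht_insert_def set_pmf_of_set lessThan_empty_iff)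

text \<open>Fullness makes every cell contribute a fingerprint and \<open>qht_wf\<close> makes these
  distinct. The count therefore does not depend on the table, and neither does the drift computed
  from it.\<close>

lemma card_stored:
  assumes "qht_wf N k S T" "qht_full N k T" "r < N"
  shows "card {f. f < S \<and> qht_stored k T r f} = k"
proof -
  have inj: "inj_on (\<lambda>j. the (T r j)) {..<k}"
    using assms unfolding qht_wf_def qht_full_def inj_on_def
    by (metis lessThan_iff option.expand)
  have "{f. f < S \<and> qht_stored k T r f} = (\<lambda>j. the (T r j)) ` {..<k}"
  proof (intro equalityI subsetI)
    fix f assume "f \<in> {f. f < S \<and> qht_stored k T r f}"
    then obtain j where "j < k" "T r j = Some f" by (auto simp: qht_stored_def)
    then show "f \<in> (\<lambda>j. the (T r j)) ` {..<k}" by (intro image_eqI[of _ _ j]) auto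
  next
    fix f assume "f \<in> (\<lambda>j. the (T r j)) ` {..<k}"
    then obtain j where j: "j < k" "f = the (T r j)" by auto
    then have "T r j = Some f" using assms(2,3) unfolding qht_full_def by auto
    then show "f \<in> {f. f < S \<and> qht_stored k T r f}"
      using j(1) assms(1,3) unfolding qht_wf_def qht_stored_def by blast
  qed
  then show ?thesis using card_image[OF inj] by simp
qed

section \<open>One-step evolution of the presence of a fingerprint\<close>

text \<open>The pair \<open>p\<close> is fixed here; the only randomness is the choice of the
  overwritten cell.\<close>

definition stored_prob :: "nat \<Rightarrow> nat \<Rightarrow> nat \<Rightarrow> (nat \<times> nat) \<Rightarrow> qht_table \<Rightarrow> real" where
  "stored_prob k r f p T =
     measure_pmf.prob (qht_process k (fst p) (snd p) T) {(b, T'). qht_stored k T' r f}"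

lemma stored_prob_other_row:
  assumes "k > 0" "r' \<noteq> r"
  shows "stored_prob k r f (r', f') T = of_bool (qht_stored k T r f)"
proof -
  have *: "qht_stored k T' r f = qht_stored k T r f"
    if "(b, T') \<in> set_pmf (qht_process k r' f' T)" for b T'
    using set_pmf_qht_process[OF assms(1) that] assms(2)
    by (auto simp: qht_write_def qht_stored_def)
  show ?thesis
  proof (cases "qht_stored k T r f")
    case True
    then show ?thesis using * by (auto simp: stored_prob_def measure_pmf.prob_eq_1 AE_measure_pmf_iff)
  next
    case False
    then show ?thesis using * by (auto simp: stored_prob_def measure_pmf_zero_iff)
  qed
qed

text \<open>A fingerprint \<open>f'\<close> already present changes nothing. Otherwise it overwrites
  one of the \<open>k\<close> cells, and \<open>f\<close>, if stored, sits in exactly one of them,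
  so it is lost with probability \<open>1 / k\<close>. If \<open>f\<close> is absent, only writing
  \<open>f\<close> itself makes it present.\<close>

lemma stored_prob_same_row:
  assumes k: "k > 0" and wf: "qht_wf N k S T" "qht_full N k T" "r < N"
  shows "stored_prob k r f (r, f') T =
    (if qht_stored k T r f then (if qht_stored k T r f' then 1 else 1 - 1 / real k)
     else of_bool (f' = f))"
proof (cases "qht_stored k T r f'")
  case True
  then show ?thesis by (auto simp: stored_prob_def qht_process_def indicator_def)
next
  case False
  have full: "\<not> (\<exists>j<k. T r j = None)" using wf by (auto simp: qht_full_def)
  have ne: "{..<k} \<noteq> {}" using k by auto
  have proc: "qht_process k r f' T = map_pmf (\<lambda>j. (UNSEEN, qht_write T r j f')) (pmf_of_set {..<k})"
    unfolding qht_process_def qht_insert_def by (simp only: False full if_False map_pmf_comp)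
  have eq: "stored_prob k r f (r, f') T =
      real (card {j. j < k \<and> qht_stored k (qht_write T r j f') r f}) / real k"
    using ne by (simp add: proc stored_prob_def vimage_def measure_pmf_of_set Int_def)
  consider "f' = f" | "f' \<noteq> f" "\<not> qht_stored k T r f" | "f' \<noteq> f" "qht_stored k T r f" by blast
  then show ?thesis
  proof cases
    case 1
    then have "{j. j < k \<and> qht_stored k (qht_write T r j f') r f} = {..<k}"
      by (auto simp: qht_stored_def qht_write_def)
    then show ?thesis using eq 1 False k by simp
  next
    case 2
    then have "{j. j < k \<and> qht_stored k (qht_write T r j f') r f} = {}"
      by (auto simp: qht_stored_def qht_write_def split: if_splits)
    then show ?thesis using eq 2 by simp
  next
    case 3
    then obtain i where i: "i < k" "T r i = Some f" by (auto simp: qht_stored_def)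
    then have uniq: "j = i" if "j < k" "T r j = Some f" for j
      using wf that unfolding qht_wf_def by (metis option.distinct(1))
    have "qht_stored k (qht_write T r j f') r f \<longleftrightarrow> j \<noteq> i" for j
      unfolding qht_stored_def qht_write_def fun_upd_same using i 3(1) uniq
      by (metis fun_upd_apply option.inject)
    then have "{j. j < k \<and> qht_stored k (qht_write T r j f') r f} = {..<k} - {i}"
      by auto
    then show ?thesis using eq 3 False k i by (simp add: of_nat_diff field_simps)
  qed
qed

text \<open>Other rows leave the presence of \<open>f\<close> unchanged. In row \<open>r\<close>, a
  stored \<open>f\<close> is at risk from the \<open>S - k\<close> absent fingerprints, and an
  absent \<open>f\<close> is created by one fingerprint out of \<open>S\<close>.\<close>

lemma sum_stored_prob:
  assumes k: "k > 0" and wf: "qht_wf N k S T" "qht_full N k T" "r < N" "f < S"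
  shows "(\<Sum>p\<in>{..<N}\<times>{..<S}. stored_prob k r f p T) / (real N * real S) =
    of_bool (qht_stored k T r f) * (1 - 1 / (real N * real k)) + 1 / (real N * real S)"
proof -
  let ?st = "of_bool (qht_stored k T r f) :: real"
  have pos: "N > 0" "S > 0" using wf by auto
  have row: "(\<Sum>f'<S. stored_prob k r f (r, f') T) = ?st * (real S - real S / real k) + 1"
  proof (cases "qht_stored k T r f")
    case True
    \<comment> \<open>The summand is split into the eviction value and a bonus \<open>1 / k\<close>
      for each stored \<open>f'\<close>; \<open>card_stored\<close> says that there are
      \<open>k\<close> bonuses.\<close>
    have "(\<Sum>f'<S. stored_prob k r f (r, f') T)
        = (\<Sum>f'<S. (1 - 1 / real k) + (if qht_stored k T r f' then 1 / real k else 0))"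
      using True by (intro sum.cong) (auto simp: stored_prob_same_row[OF k wf(1-3)])
    also have "\<dots> = real S * (1 - 1 / real k) + 1"
      using k card_stored[OF wf(1-3)]
      by (simp add: sum.distrib sum.If_cases Int_def)
    finally show ?thesis using True by (simp add: algebra_simps)
  next
    case False
    then have "(\<Sum>f'<S. stored_prob k r f (r, f') T) = (\<Sum>f'<S. if f' = f then 1 else 0)"
      by (intro sum.cong) (auto simp: stored_prob_same_row[OF k wf(1-3)])
    then show ?thesis using False wf by simp
  qed
  have "(\<Sum>p\<in>{..<N}\<times>{..<S}. stored_prob k r f p T) = (\<Sum>r'<N. \<Sum>f'<S. stored_prob k r f (r', f') T)"
    by (simp add: sum.cartesian_product)
  also have "\<dots> = (\<Sum>f'<S. stored_prob k r f (r, f') T)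
      + (\<Sum>r'\<in>{..<N}-{r}. \<Sum>f'<S. stored_prob k r f (r', f') T)"
    using wf by (subst sum.remove[of _ r]) auto
  also have "(\<Sum>r'\<in>{..<N}-{r}. \<Sum>f'<S. stored_prob k r f (r', f') T) = (\<Sum>r'\<in>{..<N}-{r}. \<Sum>f'<S. ?st)"
    using k by (intro sum.cong) (auto simp: stored_prob_other_row)
  also have "\<dots> = (real N - 1) * real S * ?st"
    using wf by (simp add: of_nat_diff)
  finally show ?thesis using row pos k by (simp add: field_simps)
qed

section \<open>The last output after independent uniform pairs\<close>

lemma pair_pmf_of_set:
  assumes "finite A" "A \<noteq> {}" "finite B" "B \<noteq> {}"
  shows "pair_pmf (pmf_of_set A) (pmf_of_set B) = pmf_of_set (A \<times> B)"
proof (rule pmf_eqI)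
  fix x :: "'a \<times> 'b"
  show "pmf (pair_pmf (pmf_of_set A) (pmf_of_set B)) x = pmf (pmf_of_set (A \<times> B)) x"
    using assms by (cases x) (simp add: pmf_pair pmf_of_set indicator_def card_cartesian_product)
qed

text \<open>The hash pairs themselves serve as stream elements, with \<open>fst\<close> and
  \<open>snd\<close> as the two hash functions. The pair \<open>p\<close> of the last element is
  fixed and the \<open>m\<close> earlier ones are random.\<close>

definition last_output ::
  "nat \<Rightarrow> nat \<Rightarrow> nat \<Rightarrow> nat \<Rightarrow> (nat \<times> nat) \<Rightarrow> qht_table \<Rightarrow> qht_output pmf" where
  "last_output N k S m p T =
     bind_pmf (replicate_pmf m (pair_pmf (pmf_of_set {..<N}) (pmf_of_set {..<S})))
       (\<lambda>ps. map_pmf (\<lambda>bs. bs ! m) (qht_outputs k fst snd (ps @ [p]) T))"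

lemma last_output_0: "last_output N k S 0 p T = map_pmf fst (qht_process k (fst p) (snd p) T)"
  by (simp add: last_output_def bind_return_pmf map_bind_pmf case_prod_beta map_pmf_def
      bind_assoc_pmf)

text \<open>A Markov recursion on the first insertion: the later pairs are drawn independently of
  its outcome, so the two draws commute.\<close>

lemma last_output_Suc:
  "last_output N k S (Suc m) p T =
     bind_pmf (pair_pmf (pmf_of_set {..<N}) (pmf_of_set {..<S})) (\<lambda>q.
       bind_pmf (qht_process k (fst q) (snd q) T) (\<lambda>(b, T'). last_output N k S m p T'))"
proof -
  let ?U = "pair_pmf (pmf_of_set {..<N}) (pmf_of_set {..<S})"
  have "last_output N k S (Suc m) p T =
     bind_pmf ?U (\<lambda>q. bind_pmf (replicate_pmf m ?U) (\<lambda>ps.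
       bind_pmf (qht_process k (fst q) (snd q) T) (\<lambda>z.
         map_pmf (\<lambda>bs. bs ! m) (qht_outputs k fst snd (ps @ [p]) (snd z)))))"
    by (simp add: last_output_def bind_return_pmf map_bind_pmf case_prod_beta bind_assoc_pmf
        map_pmf_def)
  also have "\<dots> = bind_pmf ?U (\<lambda>q. bind_pmf (qht_process k (fst q) (snd q) T) (\<lambda>z.
       bind_pmf (replicate_pmf m ?U) (\<lambda>ps.
         map_pmf (\<lambda>bs. bs ! m) (qht_outputs k fst snd (ps @ [p]) (snd z)))))"
    by (subst bind_commute_pmf) simp
  finally show ?thesis by (simp only: last_output_def case_prod_unfold)
qed

text \<open>The deviation from the fixed point \<open>k / S\<close> shrinks by the factor
  \<open>1 - 1 / (N k)\<close> per insertion. The induction peels off the first insertion, so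
  \<open>T\<close> must be arbitrary and the invariants must pass to the next table.\<close>

lemma pmf_last_output:
  assumes k: "k > 0" and r: "r < N" and f: "f < S"
  assumes "qht_wf N k S T" "qht_full N k T"
  shows "pmf (last_output N k S m (r, f) T) DUPLICATE =
    real k / real S
      + (of_bool (qht_stored k T r f) - real k / real S) * (1 - 1 / (real N * real k)) ^ m"
  using assms(4,5)
proof (induction m arbitrary: T)
  case 0
  have "map_pmf fst (qht_process k r f T)
      = return_pmf (if qht_stored k T r f then DUPLICATE else UNSEEN)"
    by (simp add: qht_process_def map_pmf_comp map_pmf_const)
  then show ?case by (simp add: last_output_0)
next
  case (Suc m)
  let ?a = "1 - 1 / (real N * real k)" and ?c = "real k / real S"
  let ?U = "pair_pmf (pmf_of_set {..<N}) (pmf_of_set {..<S})"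
  have pos: "N > 0" "S > 0" using r f by auto
  have U: "?U = pmf_of_set ({..<N} \<times> {..<S})"
    using pair_pmf_of_set[of "{..<N}" "{..<S}"] pos by (auto simp: lessThan_empty_iff)
  have inner: "(\<integral>z. pmf (last_output N k S m (r, f) (snd z)) DUPLICATE
       \<partial>measure_pmf (qht_process k (fst q) (snd q) T))
     = ?c + (stored_prob k r f q T - ?c) * ?a ^ m" if q: "q \<in> {..<N} \<times> {..<S}" for q
  proof -
    let ?M = "measure_pmf (qht_process k (fst q) (snd q) T)"
    let ?A = "{(b, T'). qht_stored k T' r f}"
    \<comment> \<open>The induction hypothesis is affine in the indicator that \<open>f\<close> is
      stored, so the expectation over the next table needs only the probability of that
      event.\<close>
    have "(\<integral>z. pmf (last_output N k S m (r, f) (snd z)) DUPLICATE \<partial>?M)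
      = (\<integral>z. (?c - ?c * ?a ^ m) + indicator ?A z * ?a ^ m \<partial>?M)"
    proof (intro integral_cong_AE)
      show "AE z in ?M. pmf (last_output N k S m (r, f) (snd z)) DUPLICATE
        = (?c - ?c * ?a ^ m) + indicator ?A z * ?a ^ m"
      proof (rule AE_pmfI)
        fix z assume z: "z \<in> set_pmf (qht_process k (fst q) (snd q) T)"
        have "qht_wf N k S (snd z)" "qht_full N k (snd z)"
          using qht_wf_process[OF k Suc.prems(1), of "snd q" "fst z" "snd z" "fst q"]
            qht_full_process[OF k Suc.prems(2), of "fst z" "snd z" "fst q" "snd q"] z q by auto
        from Suc.IH[OF this] show "pmf (last_output N k S m (r, f) (snd z)) DUPLICATE
          = (?c - ?c * ?a ^ m) + indicator ?A z * ?a ^ m"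
          by (simp add: algebra_simps indicator_def case_prod_beta)
      qed
    qed auto
    also have "\<dots> = (?c - ?c * ?a ^ m) + measure ?M ?A * ?a ^ m"
      by (subst Bochner_Integration.integral_add)
        (auto intro!: integrable_measure_pmf_finite finite_set_pmf_qht_process k)
    finally show ?thesis by (simp add: stored_prob_def algebra_simps)
  qed
  have "pmf (last_output N k S (Suc m) (r, f) T) DUPLICATE
     = (\<integral>q. (\<integral>z. pmf (last_output N k S m (r, f) (snd z)) DUPLICATE
       \<partial>measure_pmf (qht_process k (fst q) (snd q) T)) \<partial>measure_pmf ?U)"
    by (simp add: last_output_Suc pmf_bind case_prod_beta)
  also have "\<dots> = (\<Sum>q\<in>{..<N}\<times>{..<S}. ?c + (stored_prob k r f q T - ?c) * ?a ^ m) / (real N * real S)"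
    unfolding U using pos
    by (subst integral_pmf_of_set) (auto simp: inner lessThan_empty_iff cong: sum.cong)
  also have "\<dots> = ?c + ((\<Sum>q\<in>{..<N}\<times>{..<S}. stored_prob k r f q T) / (real N * real S) - ?c) * ?a ^ m"
    using pos by (simp add: sum.distrib sum_subtractf flip: sum_distrib_right)
      (simp add: field_simps)
  also have "(\<Sum>q\<in>{..<N}\<times>{..<S}. stored_prob k r f q T) / (real N * real S)
      = of_bool (qht_stored k T r f) * ?a + 1 / (real N * real S)"
    using sum_stored_prob[OF k Suc.prems r f] .
  \<comment> \<open>This is the fixed-point identity
    \<open>?c * ?a + 1 / (N S) = ?c\<close>.\<close>
  also have "\<dots> - ?c = (of_bool (qht_stored k T r f) - ?c) * ?a"
    using pos k by (simp add: field_simps)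
  finally show ?case by (simp add: mult.assoc)
qed

section \<open>From random functions to independent hash pairs\<close>

lemma qht_outputs_map:
  "qht_outputs k h s es T = qht_outputs k fst snd (map (\<lambda>x. (h x, s x)) es) T"
  by (induction es arbitrary: T) auto

text \<open>A random function has independent values at distinct points. The induction removes the
  head \<open>x\<close> from the domain as well, since by distinctness the value at \<open>x\<close>
  does not affect the values on the tail.\<close>

lemma map_pair_Pi_pmf:
  assumes "finite A" "distinct es" "set es \<subseteq> A"
  shows "map_pmf (\<lambda>(h, s). map (\<lambda>x. (h x, s x)) es)
      (pair_pmf (Pi_pmf A d (\<lambda>_. P)) (Pi_pmf A d' (\<lambda>_. Q)))
    = replicate_pmf (length es) (pair_pmf P Q)"
  using assms
proof (induction es arbitrary: A)
  case Nil
  then show ?case by (simp add: case_prod_beta map_pmf_const)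
next
  case (Cons x es)
  let ?P = "Pi_pmf (A - {x}) d (\<lambda>_. P)" and ?Q = "Pi_pmf (A - {x}) d' (\<lambda>_. Q)"
  have A: "insert x (A - {x}) = A" using Cons.prems by auto
  have P: "Pi_pmf A d (\<lambda>_. P) = bind_pmf P (\<lambda>y. bind_pmf ?P (\<lambda>h. return_pmf (h(x := y))))"
    using Pi_pmf_insert'[of "A - {x}" x d "\<lambda>_. P"] Cons.prems(1) by (simp only: A) simp
  have Q: "Pi_pmf A d' (\<lambda>_. Q) = bind_pmf Q (\<lambda>y. bind_pmf ?Q (\<lambda>h. return_pmf (h(x := y))))"
    using Pi_pmf_insert'[of "A - {x}" x d' "\<lambda>_. Q"] Cons.prems(1) by (simp only: A) simp
  have upd: "map (\<lambda>z. ((h(x := y)) z, (s(x := y')) z)) es = map (\<lambda>z. (h z, s z)) es" for h s y y'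
    using Cons.prems by (auto simp: map_eq_conv)
  have IH: "map_pmf (\<lambda>(h, s). map (\<lambda>x. (h x, s x)) es) (pair_pmf ?P ?Q)
      = replicate_pmf (length es) (pair_pmf P Q)"
    using Cons.prems by (intro Cons.IH) auto
  have "map_pmf (\<lambda>(h, s). map (\<lambda>x. (h x, s x)) (x # es))
      (pair_pmf (Pi_pmf A d (\<lambda>_. P)) (Pi_pmf A d' (\<lambda>_. Q)))
    = bind_pmf P (\<lambda>y. bind_pmf ?P (\<lambda>h. bind_pmf Q (\<lambda>y'. bind_pmf ?Q (\<lambda>s.
        return_pmf ((y, y') # map (\<lambda>x. (h x, s x)) es)))))"
    unfolding P Q pair_pmf_def map_pmf_def
    by (simp add: bind_assoc_pmf bind_return_pmf upd del: fun_upd_apply) (simp add: fun_upd_same)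
  also have "\<dots> = bind_pmf P (\<lambda>y. bind_pmf Q (\<lambda>y'. bind_pmf ?P (\<lambda>h. bind_pmf ?Q (\<lambda>s.
        return_pmf ((y, y') # map (\<lambda>x. (h x, s x)) es)))))"
    by (subst bind_commute_pmf) simp
  also have "\<dots> = bind_pmf (pair_pmf P Q) (\<lambda>y.
      map_pmf ((#) y) (map_pmf (\<lambda>(h, s). map (\<lambda>x. (h x, s x)) es) (pair_pmf ?P ?Q)))"
    by (simp add: pair_pmf_def map_pmf_def bind_assoc_pmf bind_return_pmf)
  also have "\<dots> = replicate_pmf (length (x # es)) (pair_pmf P Q)"
    unfolding IH by (simp add: map_pmf_def)
  finally show ?case .
qed

text \<open>The default must be \<open>undefined\<close>, the value that extensional functions take
  outside their domain.\<close>

lemma Pi_pmf_of_set_PiE: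
  assumes "finite A" "finite B" "B \<noteq> {}"
  shows "pmf_of_set (A \<rightarrow>\<^sub>E B) = Pi_pmf A undefined (\<lambda>_. pmf_of_set B)"
proof -
  have "PiE_dflt A undefined (\<lambda>_. B) = A \<rightarrow>\<^sub>E B"
    unfolding PiE_dflt_def set_eq_iff mem_Collect_eq PiE_iff extensional_def by blast
  then show ?thesis using assms Pi_pmf_of_set[of A "\<lambda>_. B" undefined] by simp
qed

text \<open>Mapping each outcome to its membership in \<open>X\<close> turns the measure into a
  single \<open>pmf\<close> value, to which \<open>pmf_bind\<close> applies.\<close>

lemma measure_bind_pmf:
  "measure_pmf.prob (bind_pmf M f) X = (\<integral>x. measure_pmf.prob (f x) X \<partial>measure_pmf M)"
proof -
  have "measure_pmf.prob p X = pmf (map_pmf (\<lambda>x. x \<in> X) p) True" for p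
    by (simp add: pmf_map vimage_def)
  then show ?thesis by (simp add: map_bind_pmf pmf_bind)
qed

text \<open>The list \<open>e # xs\<close> puts \<open>e\<close> first, so that its pair is drawn
  before the others; \<open>?G\<close> moves it back to the end of the stream. The pair is kept
  beside the output because the conditioning event depends on it.\<close>

lemma last_pair_output_law:
  assumes "finite \<Gamma>" "distinct (e # xs)" "set (e # xs) \<subseteq> \<Gamma>" "N > 0" "S > 0"
  shows "bind_pmf (pmf_of_set (\<Gamma> \<rightarrow>\<^sub>E {..<N})) (\<lambda>h.
      bind_pmf (pmf_of_set (\<Gamma> \<rightarrow>\<^sub>E {..<S})) (\<lambda>s.
        map_pmf (\<lambda>bs. ((h e, s e), bs ! length xs)) (qht_outputs k h s (xs @ [e]) T)))
    = bind_pmf (pair_pmf (pmf_of_set {..<N}) (pmf_of_set {..<S})) (\<lambda>p.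
        map_pmf (Pair p) (last_output N k S (length xs) p T))"
proof -
  let ?H = "Pi_pmf \<Gamma> undefined (\<lambda>_. pmf_of_set {..<N})"
  let ?F = "Pi_pmf \<Gamma> undefined (\<lambda>_. pmf_of_set {..<S})"
  let ?U = "pair_pmf (pmf_of_set {..<N}) (pmf_of_set {..<S})"
  let ?G = "\<lambda>ps. map_pmf (\<lambda>bs. (hd ps, bs ! length xs)) (qht_outputs k fst snd (tl ps @ [hd ps]) T)"
  have PiE: "pmf_of_set (\<Gamma> \<rightarrow>\<^sub>E {..<N}) = ?H" "pmf_of_set (\<Gamma> \<rightarrow>\<^sub>E {..<S}) = ?F"
    using assms by (auto intro!: Pi_pmf_of_set_PiE simp: lessThan_empty_iff)
  have out: "qht_outputs k h s (xs @ [e]) T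
      = qht_outputs k fst snd (map (\<lambda>x. (h x, s x)) xs @ [(h e, s e)]) T" for h s
    by (subst qht_outputs_map) simp
  have "bind_pmf ?H (\<lambda>h. bind_pmf ?F (\<lambda>s.
        map_pmf (\<lambda>bs. ((h e, s e), bs ! length xs)) (qht_outputs k h s (xs @ [e]) T)))
    = bind_pmf (map_pmf (\<lambda>(h, s). map (\<lambda>x. (h x, s x)) (e # xs)) (pair_pmf ?H ?F)) ?G"
    by (simp add: out bind_map_pmf pair_pmf_def bind_assoc_pmf bind_return_pmf)
  also have "map_pmf (\<lambda>(h, s). map (\<lambda>x. (h x, s x)) (e # xs)) (pair_pmf ?H ?F)
    = replicate_pmf (Suc (length xs)) ?U"
    using map_pair_Pi_pmf[OF assms(1-3)] by simp
  also have "bind_pmf \<dots> ?G = bind_pmf ?U (\<lambda>p. map_pmf (Pair p) (last_output N k S (length xs) p T))"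
    by (simp add: last_output_def map_bind_pmf map_pmf_comp bind_assoc_pmf bind_return_pmf)
  finally show ?thesis by (simp only: PiE)
qed

section \<open>The conditional false positive probability\<close>

text \<open>For each fixed stream, the joint probability is the same constant \<open>c\<close> times
  the probability of the condition. This survives averaging over streams, and \<open>c\<close> is
  the quotient once the condition has positive probability.\<close>

lemma qht_FP_eq:
  fixes \<Gamma> :: "'a set"
  assumes k: "k > 0" and wf: "qht_wf N k S T" "qht_full N k T"
    and ex: "\<exists>r<N. \<exists>f<S. \<not> qht_stored k T r f"
    and fin: "finite \<Gamma>" and m: "m < card \<Gamma>"
  shows "qht_FP \<Gamma> N k S T m = real k / real S * (1 - (1 - 1 / (real N * real k)) ^ m)"
proof -
  define c where "c = real k / real S * (1 - (1 - 1 / (real N * real k)) ^ m)"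
  let ?U = "pair_pmf (pmf_of_set {..<N}) (pmf_of_set {..<S})"
  let ?M = "qht_experiment \<Gamma> N k S T (Suc m)"
  let ?Q = "\<lambda>(es, h, s, bs :: qht_output list). unseen_at es m \<and> distinct (take m es)
          \<and> \<not> qht_stored k T (h (es ! m)) (s (es ! m))"
  let ?P = "\<lambda>(es, h :: 'a \<Rightarrow> nat, s :: 'a \<Rightarrow> nat, bs). false_positive_at es bs m"
  define K where "K = (\<lambda>es. bind_pmf (pmf_of_set (\<Gamma> \<rightarrow>\<^sub>E {..<N})) (\<lambda>h.
      bind_pmf (pmf_of_set (\<Gamma> \<rightarrow>\<^sub>E {..<S})) (\<lambda>s.
        bind_pmf (qht_outputs k h s es T) (\<lambda>bs. return_pmf (es, h, s, bs)))))"
  have M: "?M = bind_pmf (replicate_pmf (Suc m) (pmf_of_set \<Gamma>)) K"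
    unfolding qht_experiment_def K_def by (rule refl)
  have pos: "N > 0" "S > 0" using ex by auto
  have ne: "\<Gamma> \<noteq> {}" using m by auto
  have K: "measure_pmf.prob (K es) {\<omega>. ?P \<omega> \<and> ?Q \<omega>} = c * measure_pmf.prob (K es) {\<omega>. ?Q \<omega>}"
    if es: "es \<in> set_pmf (replicate_pmf (Suc m) (pmf_of_set \<Gamma>))" for es
  proof -
    have len: "length es = Suc m" and sub: "set es \<subseteq> \<Gamma>"
      using es fin ne unfolding set_replicate_pmf by auto
    obtain xs e where xe: "es = xs @ [e]" using len by (cases es rule: rev_cases) auto
    have lx: "length xs = m" using len xe by simp
    have em: "es ! m = e" "take m es = xs" using lx by (auto simp: xe nth_append)
    have unseen: "unseen_at es m \<longleftrightarrow> e \<notin> set xs"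
      unfolding unseen_at_def em in_set_conv_nth lx using lx
      by (auto simp: xe nth_append)
    have shape: "\<exists>h s bs. \<omega> = (es, h, s, bs)" if "\<omega> \<in> set_pmf (K es)" for \<omega>
      using that by (auto simp: K_def)
    show ?thesis
    proof (cases "distinct (e # xs)")
      \<comment> \<open>A repetition violates the condition, so both sides vanish.\<close>
      case False
      then have "\<not> ?Q \<omega>" if "\<omega> \<in> set_pmf (K es)" for \<omega>
        using shape[OF that] em unseen by auto
      then have "measure_pmf.prob (K es) {\<omega>. ?P \<omega> \<and> ?Q \<omega>} = 0" "measure_pmf.prob (K es) {\<omega>. ?Q \<omega>} = 0"
        unfolding measure_pmf_zero_iff by blast+
      then show ?thesis by simp
    next
      case True
      \<comment> \<open>With the stream fixed and distinct, both events depend only on the pair of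
        \<open>e\<close> and its output, and \<open>?g\<close> projects onto these.\<close>
      let ?g = "\<lambda>(es :: 'a list, h :: 'a \<Rightarrow> nat, s :: 'a \<Rightarrow> nat, bs). ((h e, s e), bs ! m)"
      let ?R = "bind_pmf ?U (\<lambda>p. map_pmf (Pair p) (last_output N k S m p T))"
      let ?V = "{p. \<not> qht_stored k T (fst p) (snd p)}"
      have "K es = bind_pmf (pmf_of_set (\<Gamma> \<rightarrow>\<^sub>E {..<N})) (\<lambda>h.
          bind_pmf (pmf_of_set (\<Gamma> \<rightarrow>\<^sub>E {..<S})) (\<lambda>s.
            map_pmf (\<lambda>bs. (es, h, s, bs)) (qht_outputs k h s (xs @ [e]) T)))"
        by (simp only: K_def map_pmf_def xe)
      then have "map_pmf ?g (K es) = bind_pmf (pmf_of_set (\<Gamma> \<rightarrow>\<^sub>E {..<N})) (\<lambda>h.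
          bind_pmf (pmf_of_set (\<Gamma> \<rightarrow>\<^sub>E {..<S})) (\<lambda>s.
            map_pmf (\<lambda>bs. ((h e, s e), bs ! m)) (qht_outputs k h s (xs @ [e]) T)))"
        by (simp only: map_bind_pmf map_pmf_comp prod.case)
      also have "\<dots> = ?R"
        using last_pair_output_law[OF fin True, of N S k T] sub pos xe lx by simp
      finally have "map_pmf ?g (K es) = ?R" .
      then have R: "measure_pmf.prob (K es) (?g -` X) = measure_pmf.prob ?R X" for X
        by (metis measure_map_pmf)
      have Q: "measure_pmf.prob (K es) {\<omega>. ?Q \<omega>} = measure_pmf.prob (K es) (?g -` (?V \<times> UNIV))"
      proof (intro measure_pmf.finite_measure_eq_AE AE_pmfI)
        fix \<omega> assume "\<omega> \<in> set_pmf (K es)"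
        then obtain h s bs where "\<omega> = (es, h, s, bs)" using shape by blast
        then show "\<omega> \<in> {\<omega>. ?Q \<omega>} \<longleftrightarrow> \<omega> \<in> ?g -` (?V \<times> UNIV)"
          using True em unseen by simp
      qed auto
      have PQ: "measure_pmf.prob (K es) {\<omega>. ?P \<omega> \<and> ?Q \<omega>}
          = measure_pmf.prob (K es) (?g -` (?V \<times> {DUPLICATE}))"
      proof (intro measure_pmf.finite_measure_eq_AE AE_pmfI)
        fix \<omega> assume "\<omega> \<in> set_pmf (K es)"
        then obtain h s bs where "\<omega> = (es, h, s, bs)" using shape by blast
        then show "\<omega> \<in> {\<omega>. ?P \<omega> \<and> ?Q \<omega>} \<longleftrightarrow> \<omega> \<in> ?g -` (?V \<times> {DUPLICATE})"
          using True em unseen by (simp add: false_positive_at_def conj_commute)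
      qed auto
      have V: "measure_pmf.prob (map_pmf (Pair p) L) (?V \<times> Y)
          = indicator ?V p * measure_pmf.prob L Y" for p Y and L :: "qht_output pmf"
        by (cases "p \<in> ?V") (auto simp: vimage_def)
      have "measure_pmf.prob ?R (?V \<times> {DUPLICATE}) = (\<integral>p. c * indicator ?V p \<partial>measure_pmf ?U)"
        unfolding measure_bind_pmf V
      proof (intro integral_cong_AE AE_pmfI)
        fix p assume "p \<in> set_pmf ?U"
        then have p: "fst p < N" "snd p < S" using pos by (auto simp: lessThan_empty_iff)
        \<comment> \<open>On \<open>?V\<close> the fingerprint is absent initially, so the closed
          form with indicator 0 is \<open>c\<close>; off \<open>?V\<close> both sides are 0.\<close>
        show "indicator ?V p * measure_pmf.prob (last_output N k S m p T) {DUPLICATE}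
            = c * indicator ?V p"
          using pmf_last_output[OF k p wf, of m]
          by (auto simp: indicator_def c_def measure_pmf_single algebra_simps)
      qed auto
      also have "\<dots> = c * measure_pmf.prob ?R (?V \<times> UNIV)"
        unfolding measure_bind_pmf V by simp
      finally show ?thesis unfolding PQ Q R .
    qed
  qed
  have "measure_pmf.prob ?M {\<omega>. ?P \<omega> \<and> ?Q \<omega>} = c * measure_pmf.prob ?M {\<omega>. ?Q \<omega>}"
    unfolding M measure_bind_pmf
    by (subst integral_mult_right_zero[symmetric], intro integral_cong_AE AE_pmfI K) auto
  \<comment> \<open>One outcome of positive probability suffices: an enumeration of
    \<open>m + 1\<close> distinct elements, with \<open>h\<close> and \<open>s\<close> constantly
    equal to a row and a fingerprint not stored there.\<close>
  moreover have "measure_pmf.prob ?M {\<omega>. ?Q \<omega>} > 0"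
  proof -
    obtain r f where rf: "r < N" "f < S" "\<not> qht_stored k T r f" using ex by auto
    obtain B where B: "B \<subseteq> \<Gamma>" "card B = Suc m"
      using obtain_subset_with_card_n[OF Suc_leI[OF m]] .
    obtain es where es: "set es = B" "distinct es"
      using finite_distinct_list B fin finite_subset by metis
    then have len: "length es = Suc m" using B distinct_card by metis
    let ?h = "\<lambda>x\<in>\<Gamma>. r" and ?s = "\<lambda>x\<in>\<Gamma>. f"
    obtain bs where bs: "bs \<in> set_pmf (qht_outputs k ?h ?s es T)"
      using set_pmf_not_empty[of "qht_outputs k ?h ?s es T"] by blast
    have "(es, ?h, ?s, bs) \<in> set_pmf ?M"
    proof -
      have "es \<in> set_pmf (replicate_pmf (Suc m) (pmf_of_set \<Gamma>))"
        using es B fin ne len unfolding set_replicate_pmf by auto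
      moreover have "?h \<in> set_pmf (pmf_of_set (\<Gamma> \<rightarrow>\<^sub>E {..<N}))" "?s \<in> set_pmf (pmf_of_set (\<Gamma> \<rightarrow>\<^sub>E {..<S}))"
        using fin rf by (subst set_pmf_of_set; auto simp: PiE_eq_empty_iff intro!: finite_PiE)+
      ultimately show ?thesis using bs unfolding M K_def set_bind_pmf set_return_pmf by blast
    qed
    \<comment> \<open>The witnesses \<open>?h\<close> and \<open>?s\<close> take the values
      \<open>r\<close> and \<open>f\<close> only on \<open>\<Gamma>\<close>, so membership is needed
      to evaluate them.\<close>
    moreover have "es ! m \<in> \<Gamma>" using es B len by (metis lessI nth_mem subsetD)
    then have "?Q (es, ?h, ?s, bs)"
      using es len rf by (auto simp: unseen_at_def nth_eq_iff_index_eq)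
    ultimately show ?thesis by (intro measure_pmf_posI[of "(es, ?h, ?s, bs)"]) auto
  qed
  ultimately show ?thesis
    unfolding qht_FP_def cond_prob_def c_def[symmetric] by (simp add: case_prod_beta)
qed

section \<open>Averaging over the stream length\<close>

text \<open>The geometric terms have a bounded total, so they vanish after division by
  \<open>n\<close>.\<close>

lemma average_geometric_tendsto:
  fixes a c :: real
  assumes "0 \<le> a" "a < 1"
  shows "(\<lambda>n. 1 / real n * (\<Sum>m = 1..n. c * (1 - a ^ m))) \<longlonglongrightarrow> c"
proof -
  \<comment> \<open>The sum of the series \<open>c * a ^ m\<close> over
    \<open>m \<ge> 1\<close>.\<close>
  define K where "K = c * a / (1 - a)"
  have eq: "(\<Sum>m = 1..n. c * (1 - a ^ m)) = c * real n - K * (1 - a ^ n)" for n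
  proof (induction n)
    case (Suc n)
    have "K = K * a + c * a"
      using assms by (simp add: K_def divide_simps) (simp add: algebra_simps)
    then have "K * a ^ n = (K * a + c * a) * a ^ n" by simp
    with Suc show ?case by (simp add: algebra_simps)
  qed simp
  have "(\<lambda>n. c - K * ((1 - a ^ n) * inverse (real n))) \<longlonglongrightarrow> c - K * ((1 - 0) * 0)"
    using assms by (intro tendsto_intros LIMSEQ_realpow_zero lim_inverse_n)
  \<comment> \<open>At \<open>n = 0\<close> the left side is \<open>c\<close> and the right side is
    0, so equality is claimed only eventually.\<close>
  moreover have "eventually (\<lambda>n. c - K * ((1 - a ^ n) * inverse (real n))
      = 1 / real n * (\<Sum>m = 1..n. c * (1 - a ^ m))) sequentially"
    using eventually_gt_at_top[of 0]
  proof eventually_elim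
    case (elim n)
    then show ?case unfolding eq by (simp add: right_diff_distrib divide_inverse mult.commute)
  qed
  ultimately show ?thesis by (simp add: tendsto_cong)
qed

theorem theorem2:
  fixes N k S :: nat and T0 :: qht_table
  assumes "1 \<le> N" and "1 \<le> k" and "k \<le> S"
    and "qht_reachable N k S T0" and "qht_full N k T0"
    and "\<exists>r<N. \<exists>f<S. \<not> qht_stored k T0 r f"
  shows "(\<forall>(\<Gamma> :: 'a set) m. finite \<Gamma> \<and> m < card \<Gamma> \<longrightarrow>
            qht_FP \<Gamma> N k S T0 m = real k / real S * (1 - (1 - 1 / (real N * real k)) ^ m))
       \<and> (\<forall>\<Gamma> :: nat \<Rightarrow> 'a set. (\<forall>n. finite (\<Gamma> n) \<and> n < card (\<Gamma> n)) \<longrightarrow>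
            (\<lambda>n. qht_FPR (\<Gamma> n) N k S T0 n) \<longlonglongrightarrow> real k / real S)"
proof -
  have k: "k > 0" using assms(2) by simp
  have FP: "qht_FP \<Gamma> N k S T0 m = real k / real S * (1 - (1 - 1 / (real N * real k)) ^ m)"
    if "finite \<Gamma>" "m < card \<Gamma>" for \<Gamma> :: "'a set" and m
    using qht_FP_eq[OF k qht_reachable_wf[OF assms(4) k] assms(5,6) that] .
  have "(\<lambda>n. qht_FPR (\<Gamma> n) N k S T0 n) \<longlonglongrightarrow> real k / real S"
    if \<Gamma>: "\<forall>n. finite (\<Gamma> n) \<and> n < card (\<Gamma> n)" for \<Gamma> :: "nat \<Rightarrow> 'a set"
  proof -
    \<comment> \<open>The value does not depend on the alphabet, so letting
      \<open>\<Gamma> n\<close> vary with \<open>n\<close> still averages one fixed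
      sequence.\<close>
    have "qht_FP (\<Gamma> n) N k S T0 m = real k / real S * (1 - (1 - 1 / (real N * real k)) ^ m)"
      if "m \<le> n" for m n
      using \<Gamma> that le_less_trans by (intro FP) blast+
    then have "qht_FPR (\<Gamma> n) N k S T0 n
        = 1 / real n * (\<Sum>m = 1..n. real k / real S * (1 - (1 - 1 / (real N * real k)) ^ m))" for n
      unfolding qht_FPR_def by (intro arg_cong2[where f = "(*)"] sum.cong) auto
    moreover have "1 \<le> real N * real k"
      \<comment> \<open>The ratio is 0 when \<open>N = k = 1\<close>, which the averaging lemma
        admits.\<close>
      using mult_mono[of 1 "real N" 1 "real k"] assms(1,2) by simp
    then have "0 \<le> 1 - 1 / (real N * real k)" "1 - 1 / (real N * real k) < 1" by auto
    ultimately show ?thesis using average_geometric_tendsto by presburger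
  qed
  then show ?thesis using FP by blast
qed

end
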